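(* Assume the steady-state problem (S) has a solution $\rho^\epsilon\in C^\infty[0,1]$ and that it is the unique solution of (S) in $C^\infty[0,1]$. Then for every $\sigma\in X$, $\Phi(t,\sigma)\to\rho^\epsilon$ uniformly on $[0,1]$ as $t\to+\infty$.
   Context: Fix $\epsilon>0$, constants $\Omega_A>0$, $\Omega_D>0$, and $\alpha,\beta\in\mathbb{R}$. Problem (P) is: $\phi_t=\epsilon\big[\tfrac{\epsilon}{2}\phi_{xx}+(2\phi-1)\phi_x+\Omega_A(1-\phi)-\Omega_D\phi\big]$ for $0<x<1$, $t>0$; $\phi(0,t)=\alpha$, $\phi(1,t)=1-\beta$; $\phi(x,0)=\sigma(x)$. Problem (S) is: $\tfrac{\epsilon}{2}\rho_{xx}+(2\rho-1)\rho_x+\Omega_A(1-\rho)-\Omega_D\rho=0$ on $(0,1)$, $\rho(0)=\alpha$, $\rho(1)=1-\beta$. $X:=\{f\in C[0,1]: f(0)=\alpha, f(1)=1-\beta\}$ with the sup norm. For $\sigma\in X$, $\phi^\epsilon(\cdot,\cdot;\sigma)$ denotes the unique solution of (P) in $C([0,1]\times[0,\infty))\cap C^{2,1}([0,1]\times(0,\infty))$ and $\Phi(t,\sigma):=\phi^\epsilon(\cdot,t;\sigma)\in X$. *)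

theory Defs
  imports "HOL-Analysis.Analysis"
begin

definition smooth_01 :: "(real \<Rightarrow> real) \<Rightarrow> bool" where
  "smooth_01 f \<longleftrightarrow> (\<exists>D :: nat \<Rightarrow> real \<Rightarrow> real. D 0 = f \<and>
     (\<forall>n. \<forall>x\<in>{0..1}. (D n has_real_derivative D (Suc n) x) (at x within {0..1})))"

definition solves_S :: "real \<Rightarrow> real \<Rightarrow> real \<Rightarrow> real \<Rightarrow> real \<Rightarrow> (real \<Rightarrow> real) \<Rightarrow> bool" where
  "solves_S eps OA OD \<alpha> \<beta> \<rho> \<longleftrightarrow>
     (\<exists>\<rho>' \<rho>''. (\<forall>x\<in>{0..1}. (\<rho> has_real_derivative \<rho>' x) (at x within {0..1})
                       \<and> (\<rho>' has_real_derivative \<rho>'' x) (at x within {0..1}))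
       \<and> (\<forall>x\<in>{0<..<1}. eps / 2 * \<rho>'' x + (2 * \<rho> x - 1) * \<rho>' x
                          + OA * (1 - \<rho> x) - OD * \<rho> x = 0))
     \<and> \<rho> 0 = \<alpha> \<and> \<rho> 1 = 1 - \<beta>"

definition Xspace :: "real \<Rightarrow> real \<Rightarrow> (real \<Rightarrow> real) set" where
  "Xspace \<alpha> \<beta> = {f. continuous_on {0..1} f \<and> f 0 = \<alpha> \<and> f 1 = 1 - \<beta>}"

definition solves_P :: "real \<Rightarrow> real \<Rightarrow> real \<Rightarrow> real \<Rightarrow> real \<Rightarrow> (real \<Rightarrow> real)
                         \<Rightarrow> (real \<Rightarrow> real \<Rightarrow> real) \<Rightarrow> bool" where
  "solves_P eps OA OD \<alpha> \<beta> \<sigma> \<phi> \<longleftrightarrow>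
     continuous_on ({0..1} \<times> {0..}) (\<lambda>(x, t). \<phi> x t)
     \<and> (\<exists>\<phi>x \<phi>xx \<phi>t.
          continuous_on ({0..1} \<times> {0<..}) (\<lambda>(x, t). \<phi>x x t)
        \<and> continuous_on ({0..1} \<times> {0<..}) (\<lambda>(x, t). \<phi>xx x t)
        \<and> continuous_on ({0..1} \<times> {0<..}) (\<lambda>(x, t). \<phi>t x t)
        \<and> (\<forall>x\<in>{0..1}. \<forall>t>0.
              ((\<lambda>y. \<phi> y t) has_real_derivative \<phi>x x t) (at x within {0..1})
            \<and> ((\<lambda>y. \<phi>x y t) has_real_derivative \<phi>xx x t) (at x within {0..1})
            \<and> ((\<lambda>s. \<phi> x s) has_real_derivative \<phi>t x t) (at t))
        \<and> (\<forall>x\<in>{0<..<1}. \<forall>t>0.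
              \<phi>t x t = eps * (eps / 2 * \<phi>xx x t + (2 * \<phi> x t - 1) * \<phi>x x t
                               + OA * (1 - \<phi> x t) - OD * \<phi> x t)))
     \<and> (\<forall>t\<ge>0. \<phi> 0 t = \<alpha> \<and> \<phi> 1 t = 1 - \<beta>)
     \<and> (\<forall>x\<in>{0..1}. \<phi> x 0 = \<sigma> x)"

end

theory Submission
  imports Defs
begin

text \<open>
  With \<open>w = \<phi> - \<rho>\<close> and \<open>b = \<phi> + \<rho> - 1\<close>, the difference of the two equations is in divergence
  form, \<open>w\<^sub>t = eps (eps/2 w\<^sub>x\<^sub>x + (b w)\<^sub>x - (OA + OD) w)\<close>, so the \<open>L\<^sup>1\<close> norm of \<open>w\<close> decays.
  Running this argument with a uniformly convex regularisation \<open>\<integral> eta(w)\<close> of the \<open>L\<^sup>1\<close> norm also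
  keeps a share of the dissipation \<open>\<integral> w\<^sub>x\<^sup>2\<close>, which therefore becomes small at some time in each late
  unit interval; as \<open>w\<close> vanishes at \<open>x = 0\<close>, it is then uniformly small. Between such
  times the maximum principle limits the growth of \<open>sup |w|\<close> to a factor \<open>exp (2 eps sup |\<rho>'|)\<close>,
  because \<open>w\<^sub>t = eps (eps/2 w\<^sub>x\<^sub>x + (2 \<phi> - 1) w\<^sub>x + (2 \<rho>' - OA - OD) w)\<close>.
\<close>

lemma second_derivative_at_max_nonpos:
  fixes f f' :: "real \<Rightarrow> real"
  assumes "a < x" "x < b"
    and f: "\<And>y. a < y \<Longrightarrow> y < b \<Longrightarrow> (f has_real_derivative f' y) (at y)"
    and f': "(f' has_real_derivative c) (at x)"
    and max: "\<And>y. a < y \<Longrightarrow> y < b \<Longrightarrow> f y \<le> f x"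
  shows "f' x = 0" "c \<le> 0"
proof -
  show 0: "f' x = 0"
  proof (rule DERIV_local_max[OF f[OF assms(1,2)]])
    show "0 < min (x - a) (b - x)" using assms(1,2) by simp
    show "\<forall>y. \<bar>x - y\<bar> < min (x - a) (b - x) \<longrightarrow> f y \<le> f x"
      by (intro allI impI max) auto
  qed
  show "c \<le> 0"
  proof (rule ccontr)
    assume "\<not> c \<le> 0"
    then obtain d where d: "d > 0" "\<And>h. 0 < h \<Longrightarrow> h < d \<Longrightarrow> f' x < f' (x + h)"
      using DERIV_pos_inc_right[OF f'] by auto
    define h where "h = min d (b - x) / 2"
    have h: "0 < h" "h < d" "x + h < b"
      using d(1) assms(2) by (auto simp: h_def min_def field_simps)
    obtain z where z: "x < z" "z < x + h" "f (x + h) - f x = (x + h - x) * f' z"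
      using MVT2[of x "x + h" f f'] f h assms(1) by auto
    have "f' z > 0" using d(2)[of "z - x"] z(1,2) h 0 by auto
    then have "f (x + h) - f x > 0" using z(3) h by simp
    then show False using max[of "x + h"] h assms(1) by simp
  qed
qed

lemma parabolic_maximum_principle:
  fixes z zx zxx zt :: "real \<Rightarrow> real \<Rightarrow> real"
  assumes cont: "continuous_on ({0..1} \<times> {a..b}) (\<lambda>(x, t). z x t)"
    and zx: "\<And>x t. 0 < x \<Longrightarrow> x < 1 \<Longrightarrow> a < t \<Longrightarrow> t \<le> b \<Longrightarrow>
               ((\<lambda>y. z y t) has_real_derivative zx x t) (at x)"
    and zxx: "\<And>x t. 0 < x \<Longrightarrow> x < 1 \<Longrightarrow> a < t \<Longrightarrow> t \<le> b \<Longrightarrow>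
               ((\<lambda>y. zx y t) has_real_derivative zxx x t) (at x)"
    and zt: "\<And>x t. 0 < x \<Longrightarrow> x < 1 \<Longrightarrow> a < t \<Longrightarrow> t \<le> b \<Longrightarrow>
               ((\<lambda>s. z x s) has_real_derivative zt x t) (at t)"
    and sides: "\<And>t. a \<le> t \<Longrightarrow> t \<le> b \<Longrightarrow> z 0 t \<le> 0 \<and> z 1 t \<le> 0"
    and initial: "\<And>x. 0 \<le> x \<Longrightarrow> x \<le> 1 \<Longrightarrow> z x a \<le> 0"
    and strict: "\<And>x t. 0 < x \<Longrightarrow> x < 1 \<Longrightarrow> a < t \<Longrightarrow> t \<le> b \<Longrightarrow> 0 < z x t \<Longrightarrow>
               zx x t = 0 \<Longrightarrow> zxx x t \<le> 0 \<Longrightarrow> zt x t < 0"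
    and xt: "0 \<le> x" "x \<le> 1" "a \<le> t" "t \<le> b"
  shows "z x t \<le> 0"
proof (rule ccontr)
  assume pos: "\<not> z x t \<le> 0"
  have "compact ({0..1::real} \<times> {a..b})" "({0..1::real} \<times> {a..b}) \<noteq> {}"
    using xt by (auto intro: compact_Times)
  from continuous_attains_sup[OF this cont] obtain p q where
    pq: "0 \<le> p" "p \<le> 1" "a \<le> q" "q \<le> b"
    and max: "\<And>y s. 0 \<le> y \<Longrightarrow> y \<le> 1 \<Longrightarrow> a \<le> s \<Longrightarrow> s \<le> b \<Longrightarrow> z y s \<le> z p q"
    by force
  have zpos: "z p q > 0" using max[of x t] xt pos by simp
  then have "p \<noteq> 0" "p \<noteq> 1" "q \<noteq> a"
    using sides[of q] initial[of p] pq by auto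
  then have int: "0 < p" "p < 1" "a < q" using pq by auto
  have "zx p q = 0" "zxx p q \<le> 0"
    using second_derivative_at_max_nonpos[OF int(1,2) _ zxx[OF int pq(4)], of "\<lambda>y. z y q"]
      zx max int pq by auto
  then have "zt p q < 0" using strict int pq zpos by blast
  then obtain d where d: "d > 0" "\<And>h. 0 < h \<Longrightarrow> h < d \<Longrightarrow> z p q < z p (q - h)"
    using DERIV_neg_dec_left[OF zt[OF int pq(4)]] by auto
  define h where "h = min d (q - a) / 2"
  have "0 < h" "h < d" "h < q - a"
    using d(1) int by (auto simp: h_def min_def field_simps)
  then show False using d(2)[of h] max[of p "q - h"] pq by auto
qed

text \<open>
  The factor \<open>\<mu>\<close> is fixed below so that the transport contribution of \<open>\<mu> s\<^sup>2 / 2\<close> is absorbed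
  by half of the \<open>L\<^sup>1\<close> decay for \<open>|s| \<le> N\<close>; the error due to the smoothing is \<open>O(\<delta>)\<close>.
\<close>

definition eta :: "real \<Rightarrow> real \<Rightarrow> real \<Rightarrow> real" where
  "eta \<delta> \<mu> s = sqrt (s\<^sup>2 + \<delta>\<^sup>2) + \<mu> * s\<^sup>2 / 2"

definition eta' :: "real \<Rightarrow> real \<Rightarrow> real \<Rightarrow> real" where
  "eta' \<delta> \<mu> s = s / sqrt (s\<^sup>2 + \<delta>\<^sup>2) + \<mu> * s"

definition eta'' :: "real \<Rightarrow> real \<Rightarrow> real \<Rightarrow> real" where
  "eta'' \<delta> \<mu> s = \<delta>\<^sup>2 / sqrt (s\<^sup>2 + \<delta>\<^sup>2) ^ 3 + \<mu>"

lemma sq_plus_pos: "\<delta> > 0 \<Longrightarrow> s\<^sup>2 + \<delta>\<^sup>2 > (0::real)"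
  by (simp add: add_nonneg_pos)

lemma eta_deriv:
  assumes "\<delta> > 0"
  shows "(eta \<delta> \<mu> has_real_derivative eta' \<delta> \<mu> s) (at s within S)"
proof -
  have "s\<^sup>2 + \<delta>\<^sup>2 > 0" by (rule sq_plus_pos[OF assms])
  then show ?thesis unfolding eta_def [abs_def] eta'_def
    by (auto intro!: derivative_eq_intros simp: field_simps)
qed

lemma eta'_deriv:
  assumes "\<delta> > 0"
  shows "(eta' \<delta> \<mu> has_real_derivative eta'' \<delta> \<mu> s) (at s within S)"
proof -
  define r where "r = sqrt (s\<^sup>2 + \<delta>\<^sup>2)"
  have pos: "s\<^sup>2 + \<delta>\<^sup>2 > 0" by (rule sq_plus_pos[OF assms])
  then have r: "r > 0" "r\<^sup>2 = s\<^sup>2 + \<delta>\<^sup>2" by (auto simp: r_def)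
  have "(eta' \<delta> \<mu> has_real_derivative (1 * r - s * (s / r)) / (r * r) + \<mu>) (at s within S)"
    unfolding eta'_def [abs_def] r_def using pos
    by (auto intro!: derivative_eq_intros simp: field_simps)
  moreover have "(1 * r - s * (s / r)) / (r * r) + \<mu> = eta'' \<delta> \<mu> s"
  proof -
    have "(1 * r - s * (s / r)) / (r * r) = (r\<^sup>2 - s\<^sup>2) / r ^ 3"
      using r(1) by (simp add: field_simps power2_eq_square power3_eq_cube)
    then show ?thesis using r(2) unfolding eta''_def r_def[symmetric] by simp
  qed
  ultimately show ?thesis by simp
qed

lemma eta_nonneg: "\<mu> \<ge> 0 \<Longrightarrow> eta \<delta> \<mu> s \<ge> 0"
  unfolding eta_def by simp

lemma continuous_on_eta: "\<delta> > 0 \<Longrightarrow> continuous_on S (eta \<delta> \<mu>)"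
  by (meson DERIV_continuous continuous_on_eq_continuous_within eta_deriv)

lemma continuous_on_eta': "\<delta> > 0 \<Longrightarrow> continuous_on S (eta' \<delta> \<mu>)"
  by (meson DERIV_continuous continuous_on_eq_continuous_within eta'_deriv)

lemma energy_density_bound:
  fixes eps K N \<delta> \<mu> s p b :: real
  assumes "eps > 0" "K > 0" "N > 0" "\<delta> > 0" and \<mu>: "\<mu> = eps * K / (2 * N ^ 3)"
    and s: "\<bar>s\<bar> \<le> N" and b: "\<bar>b\<bar> \<le> N"
  shows "- eta'' \<delta> \<mu> s * p * (eps / 2 * p + b * s) - K * (eta' \<delta> \<mu> s * s)
         \<le> - (K / 2) * eta \<delta> \<mu> s + (N\<^sup>2 / eps + K) * \<delta> - eps * \<mu> / 4 * p\<^sup>2"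
proof -
  define r where "r = sqrt (s\<^sup>2 + \<delta>\<^sup>2)"
  have r2: "r\<^sup>2 = s\<^sup>2 + \<delta>\<^sup>2" and r: "r > 0" using sq_plus_pos[OF \<open>\<delta> > 0\<close>, of s]
    by (auto simp: r_def)
  have "\<delta> \<le> r" "\<bar>s\<bar> \<le> r" unfolding r_def by (auto intro: real_le_rsqrt)
  have \<mu>0: "\<mu> > 0" using assms by simp
  have e1: "eta' \<delta> \<mu> s * s = r - \<delta>\<^sup>2 / r + \<mu> * s\<^sup>2"
  proof -
    have "s\<^sup>2 / r = r - \<delta>\<^sup>2 / r" using r r2 by (simp add: field_simps power2_eq_square)
    then show ?thesis unfolding eta'_def r_def[symmetric]
      by (simp add: algebra_simps power2_eq_square)
  qed
  have "\<delta>\<^sup>2 / r \<le> \<delta>" using r \<open>\<delta> \<le> r\<close> \<open>\<delta> > 0\<close> by (simp add: field_simps power2_eq_square)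
  with e1 have e1': "r - \<delta> + \<mu> * s\<^sup>2 \<le> eta' \<delta> \<mu> s * s" by simp
  have e2: "eta'' \<delta> \<mu> s * s\<^sup>2 \<le> \<delta> + \<mu> * s\<^sup>2"
  proof -
    have "\<delta> * s\<^sup>2 \<le> r * r\<^sup>2"
      using \<open>\<delta> \<le> r\<close> r r2 \<open>\<delta> > 0\<close> by (intro mult_mono) auto
    then have "\<delta>\<^sup>2 * s\<^sup>2 \<le> \<delta> * r ^ 3"
      using \<open>\<delta> > 0\<close> by (simp add: power2_eq_square power3_eq_cube)
    then have "\<delta>\<^sup>2 / r ^ 3 * s\<^sup>2 \<le> \<delta>" using r by (simp add: field_simps)
    then show ?thesis unfolding eta''_def r_def[symmetric] by (simp add: algebra_simps)
  qed
  have e3: "\<mu> \<le> eta'' \<delta> \<mu> s" unfolding eta''_def by simp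
  have young: "- p * (eps / 2 * p + b * s) \<le> - (eps / 4) * p\<^sup>2 + N\<^sup>2 / eps * s\<^sup>2"
  proof -
    have "0 \<le> (eps / 2 * p + b * s)\<^sup>2 / eps" using assms by simp
    also have "\<dots> = eps / 4 * p\<^sup>2 + p * b * s + b\<^sup>2 * s\<^sup>2 / eps"
      using assms(1) by (simp add: field_simps power2_eq_square)
    finally have "- p * (eps / 2 * p + b * s) \<le> - (eps / 4) * p\<^sup>2 + b\<^sup>2 * s\<^sup>2 / eps"
      by (simp add: algebra_simps power2_eq_square)
    moreover have "b\<^sup>2 * s\<^sup>2 / eps \<le> N\<^sup>2 * s\<^sup>2 / eps"
      using assms(1) b abs_le_square_iff[of b N] \<open>N > 0\<close>
      by (intro divide_right_mono mult_right_mono) auto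
    ultimately show ?thesis by simp
  qed
  have "- eta'' \<delta> \<mu> s * p * (eps / 2 * p + b * s)
        \<le> eta'' \<delta> \<mu> s * (- (eps / 4) * p\<^sup>2 + N\<^sup>2 / eps * s\<^sup>2)"
    using mult_left_mono[OF young, of "eta'' \<delta> \<mu> s"] e3 \<mu>0 by (simp add: mult.assoc)
  also have "\<dots> = - (eps / 4 * p\<^sup>2) * eta'' \<delta> \<mu> s + N\<^sup>2 / eps * (eta'' \<delta> \<mu> s * s\<^sup>2)"
    by (simp add: algebra_simps)
  also have "\<dots> \<le> - (eps / 4 * p\<^sup>2) * \<mu> + N\<^sup>2 / eps * (\<delta> + \<mu> * s\<^sup>2)"
    using e2 e3 assms(1) by (intro add_mono mult_left_mono mult_left_mono_neg) auto
  finally have A: "- eta'' \<delta> \<mu> s * p * (eps / 2 * p + b * s)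
      \<le> - eps * \<mu> / 4 * p\<^sup>2 + N\<^sup>2 / eps * \<delta> + N\<^sup>2 / eps * (\<mu> * s\<^sup>2)"
    by (simp add: algebra_simps)
  have "s\<^sup>2 \<le> N * r"
    using mult_mono[OF s \<open>\<bar>s\<bar> \<le> r\<close>] \<open>N > 0\<close> by (simp add: power2_eq_square)
  then have "N\<^sup>2 / eps * (\<mu> * s\<^sup>2) \<le> N\<^sup>2 / eps * (\<mu> * (N * r))"
    using assms(1) \<mu>0 by (intro mult_left_mono) auto
  also have "\<dots> = K / 2 * r"
    unfolding \<mu> using assms(1,3) by (simp add: field_simps power2_eq_square power3_eq_cube)
  finally have B: "N\<^sup>2 / eps * (\<mu> * s\<^sup>2) \<le> K / 2 * r" .
  have C: "K * (r - \<delta> + \<mu> * s\<^sup>2) \<le> K * (eta' \<delta> \<mu> s * s)"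
    using e1' assms(2) by (intro mult_left_mono) auto
  have D: "0 \<le> K * (\<mu> * s\<^sup>2)" using assms(2) \<mu>0 by simp
  have "- (K / 2) * eta \<delta> \<mu> s = - (K / 2) * r - K * (\<mu> * s\<^sup>2) / 4"
    unfolding eta_def r_def[symmetric] by (simp add: algebra_simps)
  moreover have "K * (r - \<delta> + \<mu> * s\<^sup>2) = K * r - K * \<delta> + K * (\<mu> * s\<^sup>2)"
    "(N\<^sup>2 / eps + K) * \<delta> = N\<^sup>2 / eps * \<delta> + K * \<delta>"
    by (simp_all add: algebra_simps)
  ultimately show ?thesis using A B C D by linarith
qed

lemma energy_dissipation:
  fixes w wx wxx wt b bx :: "real \<Rightarrow> real"
  assumes "eps > 0" "K > 0" "N > 0" "\<delta> > 0" and \<mu>: "\<mu> = eps * K / (2 * N ^ 3)"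
    and w: "\<And>x. x \<in> {0..1} \<Longrightarrow> (w has_real_derivative wx x) (at x within {0..1})"
    and wx: "\<And>x. x \<in> {0..1} \<Longrightarrow> (wx has_real_derivative wxx x) (at x within {0..1})"
    and b: "\<And>x. x \<in> {0..1} \<Longrightarrow> (b has_real_derivative bx x) (at x within {0..1})"
    and wt: "continuous_on {0..1} wt"
    and bc: "w 0 = 0" "w 1 = 0"
    and bounds: "\<And>x. x \<in> {0..1} \<Longrightarrow> \<bar>w x\<bar> \<le> N" "\<And>x. x \<in> {0..1} \<Longrightarrow> \<bar>b x\<bar> \<le> N"
    and eq: "\<And>x. 0 < x \<Longrightarrow> x < 1 \<Longrightarrow>
               wt x = eps * (eps / 2 * wxx x + b x * wx x + bx x * w x - K * w x)"
  shows "integral {0..1} (\<lambda>x. eta' \<delta> \<mu> (w x) * wt x)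
         \<le> - (eps * K / 2) * integral {0..1} (\<lambda>x. eta \<delta> \<mu> (w x))
           + (N\<^sup>2 + eps * K) * \<delta> - eps\<^sup>2 * \<mu> / 4 * integral {0..1} (\<lambda>x. (wx x)\<^sup>2)"
proof -
  have cw: "continuous_on {0..1} w" and cwx: "continuous_on {0..1} wx"
    and cb: "continuous_on {0..1} b"
    using w wx b by (meson DERIV_continuous continuous_on_eq_continuous_within)+
  define F' where "F' x = eta'' \<delta> \<mu> (w x) * wx x * (eps / 2 * wx x + b x * w x)
     + eta' \<delta> \<mu> (w x) * (eps / 2 * wxx x + (b x * wx x + bx x * w x))" for x
  have "(F' has_integral eta' \<delta> \<mu> (w 1) * (eps / 2 * wx 1 + b 1 * w 1)
            - eta' \<delta> \<mu> (w 0) * (eps / 2 * wx 0 + b 0 * w 0)) {0..1}"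
  proof (rule fundamental_theorem_of_calculus)
    fix x :: real assume x: "x \<in> {0..1}"
    have "((\<lambda>x. eta' \<delta> \<mu> (w x)) has_real_derivative eta'' \<delta> \<mu> (w x) * wx x)
            (at x within {0..1})"
      by (rule DERIV_chain2[OF eta'_deriv[OF \<open>\<delta> > 0\<close>] w[OF x]])
    then have "((\<lambda>x. eta' \<delta> \<mu> (w x) * (eps / 2 * wx x + b x * w x))
                 has_real_derivative F' x) (at x within {0..1})"
      unfolding F'_def
      by (auto intro!: derivative_eq_intros w[OF x] wx[OF x] b[OF x] simp: algebra_simps)
    then show "((\<lambda>x. eta' \<delta> \<mu> (w x) * (eps / 2 * wx x + b x * w x))
                 has_vector_derivative F' x) (at x within {0..1})"
      by (simp add: has_real_derivative_iff_has_vector_derivative)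
  qed simp
  then have F': "(F' has_integral 0) {0..1}" by (simp add: bc eta'_def)
  have "continuous_on {0..1} (\<lambda>x. eta' \<delta> \<mu> (w x) * wt x)"
    by (intro continuous_intros wt continuous_on_compose2[OF continuous_on_eta'[OF \<open>\<delta> > 0\<close>] cw]) auto
  then have L: "((\<lambda>x. eta' \<delta> \<mu> (w x) * wt x) has_integral
      integral {0..1} (\<lambda>x. eta' \<delta> \<mu> (w x) * wt x)) {0..1}"
    by (intro integrable_integral integrable_continuous_real)
  have "continuous_on {0..1} (\<lambda>x. eta \<delta> \<mu> (w x))"
    by (intro continuous_on_compose2[OF continuous_on_eta[OF \<open>\<delta> > 0\<close>] cw]) auto
  then have I1: "((\<lambda>x. eta \<delta> \<mu> (w x)) has_integral integral {0..1} (\<lambda>x. eta \<delta> \<mu> (w x))) {0..1}"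
    by (intro integrable_integral integrable_continuous_real)
  have "continuous_on {0..1} (\<lambda>x. (wx x)\<^sup>2)" by (intro continuous_intros cwx)
  then have I2: "((\<lambda>x. (wx x)\<^sup>2) has_integral integral {0..1} (\<lambda>x. (wx x)\<^sup>2)) {0..1}"
    by (intro integrable_integral integrable_continuous_real)
  have I3: "((\<lambda>x. (N\<^sup>2 + eps * K) * \<delta>) has_integral (N\<^sup>2 + eps * K) * \<delta>) {0..1::real}"
    using has_integral_const_real[of "(N\<^sup>2 + eps * K) * \<delta>" 0 1] by simp
  show ?thesis
  proof (rule has_integral_le)
    show "((\<lambda>x. eta' \<delta> \<mu> (w x) * wt x - eps * F' x) has_integral
       integral {0..1} (\<lambda>x. eta' \<delta> \<mu> (w x) * wt x)) {0..1}"
      using has_integral_diff[OF L has_integral_mult_right[OF F', of eps]] by simp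
    show "((\<lambda>x. - (eps * K / 2) * eta \<delta> \<mu> (w x) + (N\<^sup>2 + eps * K) * \<delta>
             - eps\<^sup>2 * \<mu> / 4 * (wx x)\<^sup>2) has_integral
          - (eps * K / 2) * integral {0..1} (\<lambda>x. eta \<delta> \<mu> (w x))
           + (N\<^sup>2 + eps * K) * \<delta> - eps\<^sup>2 * \<mu> / 4 * integral {0..1} (\<lambda>x. (wx x)\<^sup>2)) {0..1}"
      by (intro has_integral_diff has_integral_add has_integral_mult_right I1 I2 I3)
  next
    fix x :: real assume x: "x \<in> {0..1}"
    have "eta' \<delta> \<mu> (w x) * wt x = eta' \<delta> \<mu> (w x) *
        (eps * (eps / 2 * wxx x + b x * wx x + bx x * w x - K * w x))"
    proof (cases "x = 0 \<or> x = 1")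
      case True
      then have "eta' \<delta> \<mu> (w x) = 0" using bc by (auto simp: eta'_def)
      then show ?thesis by simp
    next
      case False
      then show ?thesis using eq[of x] x by simp
    qed
    then have "eta' \<delta> \<mu> (w x) * wt x - eps * F' x =
       eps * (- eta'' \<delta> \<mu> (w x) * wx x * (eps / 2 * wx x + b x * w x)
              - K * (eta' \<delta> \<mu> (w x) * w x))"
      unfolding F'_def by (simp add: algebra_simps)
    also have "\<dots> \<le> eps * (- (K / 2) * eta \<delta> \<mu> (w x) + (N\<^sup>2 / eps + K) * \<delta>
                 - eps * \<mu> / 4 * (wx x)\<^sup>2)"
      using assms(1) energy_density_bound[OF assms(1-4) \<mu> bounds(1)[OF x] bounds(2)[OF x]]
      by (intro mult_left_mono) auto
    also have "\<dots> = - (eps * K / 2) * eta \<delta> \<mu> (w x) + (N\<^sup>2 + eps * K) * \<delta>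
             - eps\<^sup>2 * \<mu> / 4 * (wx x)\<^sup>2"
      using assms(1) by (simp add: field_simps power2_eq_square)
    finally show "eta' \<delta> \<mu> (w x) * wt x - eps * F' x \<le>
      - (eps * K / 2) * eta \<delta> \<mu> (w x) + (N\<^sup>2 + eps * K) * \<delta> - eps\<^sup>2 * \<mu> / 4 * (wx x)\<^sup>2" .
  qed
qed

lemma sup_le_of_derivative_L2_le:
  fixes w wx :: "real \<Rightarrow> real"
  assumes w: "\<And>x. x \<in> {0..1} \<Longrightarrow> (w has_real_derivative wx x) (at x within {0..1})"
    and cwx: "continuous_on {0..1} wx" and "w 0 = 0" and "\<theta> > 0"
    and small: "integral {0..1} (\<lambda>x. (wx x)\<^sup>2) \<le> \<theta>\<^sup>2"
    and x: "x \<in> {0..1}"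
  shows "\<bar>w x\<bar> \<le> \<theta>"
proof -
  have fin: "s * w x \<le> \<theta>" if s: "s\<^sup>2 = 1" for s :: real
  proof -
    define g where "g y = ((wx y)\<^sup>2 + \<theta>\<^sup>2) / (2 * \<theta>)" for y
    have "((\<lambda>y. s * wx y) has_integral s * w x - s * w 0) {0..x}"
      using x by (intro fundamental_theorem_of_calculus)
        (auto simp flip: has_real_derivative_iff_has_vector_derivative
          intro!: DERIV_cmult DERIV_subset[OF w])
    then have I: "((\<lambda>y. s * wx y) has_integral s * w x) {0..x}" using \<open>w 0 = 0\<close> by simp
    have cg: "continuous_on {0..1} g" unfolding g_def using \<open>\<theta> > 0\<close>
      by (intro continuous_intros cwx) auto
    have le: "s * wx y \<le> g y" for y
    proof -
      have "0 \<le> (s * wx y - \<theta>)\<^sup>2" by simp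
      also have "\<dots> = (wx y)\<^sup>2 + \<theta>\<^sup>2 - 2 * \<theta> * (s * wx y)"
        using s by (simp add: power2_diff power_mult_distrib)
      finally show ?thesis using \<open>\<theta> > 0\<close> by (simp add: g_def field_simps)
    qed
    have gi: "g integrable_on {0..x}" "g integrable_on {0..1}"
      using x by (auto intro!: integrable_continuous_real continuous_on_subset[OF cg])
    have "s * w x \<le> integral {0..x} g"
      using has_integral_le[OF I integrable_integral[OF gi(1)]] le by simp
    also have "\<dots> \<le> integral {0..1} g"
      using x gi \<open>\<theta> > 0\<close> by (intro integral_subset_le) (auto simp: g_def)
    also have "\<dots> = (integral {0..1} (\<lambda>y. (wx y)\<^sup>2) + \<theta>\<^sup>2) / (2 * \<theta>)"
    proof -
      have "((\<lambda>y. (wx y)\<^sup>2) has_integral integral {0..1} (\<lambda>y. (wx y)\<^sup>2)) {0..1}"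
        by (intro integrable_integral integrable_continuous_real continuous_intros cwx)
      moreover have "((\<lambda>y. \<theta>\<^sup>2) has_integral \<theta>\<^sup>2) {0..1::real}"
        using has_integral_const_real[of "\<theta>\<^sup>2" 0 1] by simp
      ultimately show ?thesis unfolding g_def
        by (intro integral_unique has_integral_divide has_integral_add)
    qed
    also have "\<dots> \<le> (\<theta>\<^sup>2 + \<theta>\<^sup>2) / (2 * \<theta>)"
      using small \<open>\<theta> > 0\<close> by (intro divide_right_mono) auto
    also have "\<dots> = \<theta>" using \<open>\<theta> > 0\<close> by (simp add: power2_eq_square)
    finally show ?thesis .
  qed
  show ?thesis using fin[of 1] fin[of "-1"] by simp
qed

lemma recurrent_small_dissipation:
  fixes E E' D :: "real \<Rightarrow> real"
  assumes E: "\<And>t. t > 0 \<Longrightarrow> (E has_real_derivative E' t) (at t)"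
    and E0: "\<And>t. t > 0 \<Longrightarrow> E t \<ge> 0"
    and ineq: "\<And>t. t > 0 \<Longrightarrow> E' t \<le> - c * E t + \<kappa> - d * D t"
    and D: "\<And>t. t > 0 \<Longrightarrow> D t \<ge> 0"
    and "c > 0" "\<kappa> > 0" "d > 0" and small: "\<kappa> * (2 / c + 1) < d * m"
  shows "\<exists>T0 > 0. \<forall>T \<ge> T0. \<exists>t \<in> {T..T + 1}. D t \<le> m"
proof -
  define G where "G t = exp (c * t) * (E t - \<kappa> / c)" for t
  have G: "G t \<le> G 1" if "t \<ge> 1" for t
  proof (rule DERIV_nonpos_imp_nonincreasing[OF that])
    fix s :: real assume s: "1 \<le> s" "s \<le> t"
    have "(G has_real_derivative exp (c * s) * (E' s + c * E s - \<kappa>)) (at s)"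
      unfolding G_def [abs_def] using s \<open>c > 0\<close>
      by (auto intro!: derivative_eq_intros E simp: field_simps)
    moreover have "E' s + c * E s - \<kappa> \<le> 0"
      using ineq[of s] D[of s] s \<open>d > 0\<close> mult_nonneg_nonneg[of d "D s"]
      by linarith
    ultimately show "\<exists>y. (G has_real_derivative y) (at s) \<and> y \<le> 0"
      by (auto intro!: exI mult_nonneg_nonpos)
  qed
  define T0 where "T0 = max 1 (\<bar>G 1\<bar> / \<kappa>)"
  have T0: "E T \<le> 2 * \<kappa> / c" if T: "T \<ge> T0" for T
  proof -
    have "c * T \<le> exp (c * T)" using exp_ge_add_one_self[of "c * T"] by linarith
    moreover have "\<bar>G 1\<bar> \<le> \<kappa> * T"
      using T \<open>\<kappa> > 0\<close> by (auto simp: T0_def field_simps)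
    ultimately have "c * \<bar>G 1\<bar> \<le> c * (\<kappa> * T)" "\<kappa> * (c * T) \<le> \<kappa> * exp (c * T)"
      using \<open>c > 0\<close> \<open>\<kappa> > 0\<close> by (auto intro!: mult_left_mono)
    then have "c * \<bar>G 1\<bar> \<le> \<kappa> * exp (c * T)"
      by (simp add: mult.left_commute)
    then have "G 1 \<le> exp (c * T) * (\<kappa> / c)"
      using \<open>c > 0\<close> order_trans[OF mult_left_mono[OF abs_ge_self[of "G 1"]], of c]
      by (simp add: field_simps)
    with G[of T] T have "exp (c * T) * (E T - \<kappa> / c) \<le> exp (c * T) * (\<kappa> / c)"
      by (simp add: G_def T0_def)
    then have "E T - \<kappa> / c \<le> \<kappa> / c" by (rule mult_left_le_imp_le) simp
    then show ?thesis by simp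
  qed
  have "\<exists>t \<in> {T..T + 1}. D t \<le> m" if T: "T \<ge> T0" for T
  proof (rule ccontr)
    assume "\<not> ?thesis"
    then have big: "\<And>t. T \<le> t \<Longrightarrow> t \<le> T + 1 \<Longrightarrow> m < D t" by force
    have "T > 0" using T by (simp add: T0_def)
    then obtain z where z: "T < z" "z < T + 1" "E (T + 1) - E T = (T + 1 - T) * E' z"
      using MVT2[of T "T + 1" E E'] E by force
    have "E' z \<le> \<kappa> - d * m"
    proof -
      have "0 \<le> c * E z" "d * m \<le> d * D z"
        using E0[of z] big[of z] z \<open>T > 0\<close> \<open>c > 0\<close> \<open>d > 0\<close> by auto
      then show ?thesis using ineq[of z] z \<open>T > 0\<close> by simp
    qed
    then have "E (T + 1) < 0"
      using z(3) T0[OF T] small by (simp add: algebra_simps)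
    then show False using E0[of "T + 1"] \<open>T > 0\<close> by simp
  qed
  then show ?thesis by (intro exI[of _ T0]) (auto simp: T0_def)
qed

lemma continuous_on_Icc_bounded:
  fixes f :: "real \<Rightarrow> real"
  assumes "continuous_on {a..b} f"
  shows "\<exists>B. \<forall>x\<in>{a..b}. \<bar>f x\<bar> \<le> B"
  using compact_imp_bounded[OF compact_continuous_image[OF assms compact_Icc]]
  by (simp add: bounded_iff)

locale density_and_profile =
  fixes eps OA OD \<alpha> \<beta> :: real
    and \<phi> \<phi>x \<phi>xx \<phi>t :: "real \<Rightarrow> real \<Rightarrow> real" and \<rho> \<rho>' \<rho>'' :: "real \<Rightarrow> real"
  assumes eps: "eps > 0" and OA: "OA > 0" and OD: "OD > 0"
    and cont: "continuous_on ({0..1} \<times> {0..}) (\<lambda>(x, t). \<phi> x t)"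
    and cont_t: "continuous_on ({0..1} \<times> {0<..}) (\<lambda>(x, t). \<phi>t x t)"
    and \<phi>x: "\<And>x t. x \<in> {0..1} \<Longrightarrow> t > 0 \<Longrightarrow>
              ((\<lambda>y. \<phi> y t) has_real_derivative \<phi>x x t) (at x within {0..1})"
    and \<phi>xx: "\<And>x t. x \<in> {0..1} \<Longrightarrow> t > 0 \<Longrightarrow>
              ((\<lambda>y. \<phi>x y t) has_real_derivative \<phi>xx x t) (at x within {0..1})"
    and \<phi>t: "\<And>x t. x \<in> {0..1} \<Longrightarrow> t > 0 \<Longrightarrow>
              ((\<lambda>s. \<phi> x s) has_real_derivative \<phi>t x t) (at t)"
    and pde: "\<And>x t. 0 < x \<Longrightarrow> x < 1 \<Longrightarrow> t > 0 \<Longrightarrow>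
              \<phi>t x t = eps * (eps / 2 * \<phi>xx x t + (2 * \<phi> x t - 1) * \<phi>x x t
                               + OA * (1 - \<phi> x t) - OD * \<phi> x t)"
    and \<phi>_bc: "\<And>t. t \<ge> 0 \<Longrightarrow> \<phi> 0 t = \<alpha>" "\<And>t. t \<ge> 0 \<Longrightarrow> \<phi> 1 t = 1 - \<beta>"
    and \<rho>': "\<And>x. x \<in> {0..1} \<Longrightarrow> (\<rho> has_real_derivative \<rho>' x) (at x within {0..1})"
    and \<rho>'': "\<And>x. x \<in> {0..1} \<Longrightarrow> (\<rho>' has_real_derivative \<rho>'' x) (at x within {0..1})"
    and ode: "\<And>x. 0 < x \<Longrightarrow> x < 1 \<Longrightarrow> eps / 2 * \<rho>'' x + (2 * \<rho> x - 1) * \<rho>' x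
                          + OA * (1 - \<rho> x) - OD * \<rho> x = 0"
    and \<rho>_bc: "\<rho> 0 = \<alpha>" "\<rho> 1 = 1 - \<beta>"
begin

lemma at_interior:
  assumes "0 < x" "x < (1::real)"
  shows "at x within {0..1} = at x"
  using assms by (intro at_within_interior) auto

lemma cont_\<rho>: "continuous_on {0..1} \<rho>"
  using \<rho>' by (meson DERIV_continuous continuous_on_eq_continuous_within)

lemma cont_\<rho>': "continuous_on {0..1} \<rho>'"
  using \<rho>'' by (meson DERIV_continuous continuous_on_eq_continuous_within)

lemma cont_slab: "0 \<le> a \<Longrightarrow> continuous_on ({0..1} \<times> {a..b}) (\<lambda>(x, t). \<phi> x t)"
  by (rule continuous_on_subset[OF cont]) auto

lemma density_bounded: "\<exists>M. \<forall>x\<in>{0..1}. \<forall>t\<ge>0. \<bar>\<phi> x t\<bar> \<le> M"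
proof -
  have "continuous_on {0..1} (\<lambda>x. (\<lambda>(x, t). \<phi> x t) (x, 0))"
    by (rule continuous_on_compose2[OF cont]) (auto intro!: continuous_intros)
  then obtain S where S: "\<And>x. x \<in> {0..1} \<Longrightarrow> \<bar>\<phi> x 0\<bar> \<le> S"
    using continuous_on_Icc_bounded[of 0 1 "\<lambda>x. \<phi> x 0"] unfolding prod.case by blast
  define M where "M = max 1 (max S (max \<bar>\<alpha>\<bar> \<bar>1 - \<beta>\<bar>))"
  have M: "1 \<le> M" "S \<le> M" "\<bar>\<alpha>\<bar> \<le> M" "\<bar>1 - \<beta>\<bar> \<le> M"
    by (simp_all only: M_def le_max_iff_disj order_refl simp_thms)
  have "\<bar>\<phi> x t\<bar> \<le> M" if xt: "x \<in> {0..1}" "t \<ge> 0" for x t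
  proof -
    have upper: "\<phi> x t - M \<le> 0"
    proof (rule parabolic_maximum_principle[where a = 0 and b = t and z = "\<lambda>x t. \<phi> x t - M"
          and zx = \<phi>x and zxx = \<phi>xx and zt = \<phi>t])
      show "continuous_on ({0..1} \<times> {0..t}) (\<lambda>(x, t). \<phi> x t - M)"
        using cont_slab[of 0 t] by (auto simp: case_prod_unfold intro!: continuous_intros)
    next
      fix x t :: real assume x: "0 < x" "x < 1" "0 < t"
      show "((\<lambda>y. \<phi> y t - M) has_real_derivative \<phi>x x t) (at x)"
        using \<phi>x[of x t] x at_interior[OF x(1,2)] by (auto intro!: derivative_eq_intros)
      show "((\<lambda>y. \<phi>x y t) has_real_derivative \<phi>xx x t) (at x)"
        using \<phi>xx[of x t] x at_interior[OF x(1,2)] by auto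
      show "((\<lambda>s. \<phi> x s - M) has_real_derivative \<phi>t x t) (at t)"
        using \<phi>t[of x t] x by (auto intro!: derivative_eq_intros)
      assume max: "0 < \<phi> x t - M" "\<phi>x x t = 0" "\<phi>xx x t \<le> 0"
      have "eps / 2 * \<phi>xx x t \<le> 0" using max eps by (simp add: mult_nonneg_nonpos)
      moreover have "OA * (1 - \<phi> x t) < 0" "OD * \<phi> x t > 0"
        using OA OD max M by (auto intro!: mult_pos_neg mult_pos_pos)
      ultimately show "\<phi>t x t < 0"
        unfolding pde[OF x] using eps max by (intro mult_pos_neg) auto
    next
      fix t :: real assume "0 \<le> t"
      then show "\<phi> 0 t - M \<le> 0 \<and> \<phi> 1 t - M \<le> 0" using M \<phi>_bc[of t] by auto
    next
      fix x :: real assume "0 \<le> x" "x \<le> 1"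
      then show "\<phi> x 0 - M \<le> 0" using S[of x] M by auto
    qed (use xt in auto)
    have lower: "- \<phi> x t - M \<le> 0"
    proof (rule parabolic_maximum_principle[where a = 0 and b = t and z = "\<lambda>x t. - \<phi> x t - M"
          and zx = "\<lambda>x t. - \<phi>x x t" and zxx = "\<lambda>x t. - \<phi>xx x t" and zt = "\<lambda>x t. - \<phi>t x t"])
      show "continuous_on ({0..1} \<times> {0..t}) (\<lambda>(x, t). - \<phi> x t - M)"
        using cont_slab[of 0 t] by (auto simp: case_prod_unfold intro!: continuous_intros)
    next
      fix x t :: real assume x: "0 < x" "x < 1" "0 < t"
      show "((\<lambda>y. - \<phi> y t - M) has_real_derivative - \<phi>x x t) (at x)"
        using \<phi>x[of x t] x at_interior[OF x(1,2)] by (auto intro!: derivative_eq_intros)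
      show "((\<lambda>y. - \<phi>x y t) has_real_derivative - \<phi>xx x t) (at x)"
        using \<phi>xx[of x t] x at_interior[OF x(1,2)] by (auto intro!: derivative_eq_intros)
      show "((\<lambda>s. - \<phi> x s - M) has_real_derivative - \<phi>t x t) (at t)"
        using \<phi>t[of x t] x by (auto intro!: derivative_eq_intros)
      assume max: "0 < - \<phi> x t - M" "- \<phi>x x t = 0" "- \<phi>xx x t \<le> 0"
      have "eps / 2 * \<phi>xx x t \<ge> 0" using max eps by simp
      moreover have "OA * (1 - \<phi> x t) > 0" "OD * \<phi> x t < 0"
        using OA OD max M by (auto intro!: mult_pos_neg mult_pos_pos)
      ultimately have "eps / 2 * \<phi>xx x t + (2 * \<phi> x t - 1) * \<phi>x x t
                        + OA * (1 - \<phi> x t) - OD * \<phi> x t > 0"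
        using max(2) by (simp only: neg_equal_0_iff_equal mult_zero_right)
      then have "\<phi>t x t > 0" unfolding pde[OF x] by (rule mult_pos_pos[OF eps])
      then show "- \<phi>t x t < 0" by simp
    next
      fix t :: real assume "0 \<le> t"
      then show "- \<phi> 0 t - M \<le> 0 \<and> - \<phi> 1 t - M \<le> 0" using M \<phi>_bc[of t] by auto
    next
      fix x :: real assume "0 \<le> x" "x \<le> 1"
      then show "- \<phi> x 0 - M \<le> 0" using S[of x] M by auto
    qed (use xt in auto)
    show ?thesis using upper lower by linarith
  qed
  then show ?thesis by blast
qed

lemma difference_growth:
  assumes R: "\<And>x. x \<in> {0..1} \<Longrightarrow> \<bar>\<rho>' x\<bar> \<le> R"
    and "a > 0" "a \<le> t" "x \<in> {0..1}"
    and init: "\<And>y. y \<in> {0..1} \<Longrightarrow> \<bar>\<phi> y a - \<rho> y\<bar> \<le> \<theta>"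
  shows "\<bar>\<phi> x t - \<rho> x\<bar> \<le> \<theta> * exp (2 * eps * R * (t - a))"
proof -
  define \<gamma> where "\<gamma> = 2 * eps * R"
  have \<theta>: "\<theta> \<ge> 0" using init[of 0] by auto
  have signed: "s * (\<phi> x t - \<rho> x) * exp (- \<gamma> * (t - a)) - \<theta> \<le> 0" if s: "s = 1 \<or> s = - 1" for s
  proof (rule parabolic_maximum_principle[where a = a and b = t
        and z = "\<lambda>x t. s * (\<phi> x t - \<rho> x) * exp (- \<gamma> * (t - a)) - \<theta>"
        and zx = "\<lambda>x t. s * (\<phi>x x t - \<rho>' x) * exp (- \<gamma> * (t - a))"
        and zxx = "\<lambda>x t. s * (\<phi>xx x t - \<rho>'' x) * exp (- \<gamma> * (t - a))"
        and zt = "\<lambda>x t. s * (\<phi>t x t - \<gamma> * (\<phi> x t - \<rho> x)) * exp (- \<gamma> * (t - a))"])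
    have "continuous_on ({0..1} \<times> {a..t}) (\<lambda>p. \<rho> (fst p))"
      by (rule continuous_on_compose2[OF cont_\<rho>]) (auto intro!: continuous_intros)
    then show "continuous_on ({0..1} \<times> {a..t})
        (\<lambda>(x, t). s * (\<phi> x t - \<rho> x) * exp (- \<gamma> * (t - a)) - \<theta>)"
      using cont_slab[of a t] \<open>a > 0\<close>
      by (auto simp: case_prod_unfold intro!: continuous_intros)
  next
    fix x t :: real assume x: "0 < x" "x < 1" and "a < t"
    then have t: "0 < t" using \<open>a > 0\<close> by simp
    note D = \<phi>x[of x t] \<phi>xx[of x t] \<rho>'[of x] \<rho>''[of x]
    show "((\<lambda>y. s * (\<phi> y t - \<rho> y) * exp (- \<gamma> * (t - a)) - \<theta>) has_real_derivative
        s * (\<phi>x x t - \<rho>' x) * exp (- \<gamma> * (t - a))) (at x)"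
      using D x t unfolding at_interior[OF x] by (auto intro!: derivative_eq_intros)
    show "((\<lambda>y. s * (\<phi>x y t - \<rho>' y) * exp (- \<gamma> * (t - a))) has_real_derivative
        s * (\<phi>xx x t - \<rho>'' x) * exp (- \<gamma> * (t - a))) (at x)"
      using D x t unfolding at_interior[OF x] by (auto intro!: derivative_eq_intros)
    show "((\<lambda>r. s * (\<phi> x r - \<rho> x) * exp (- \<gamma> * (r - a)) - \<theta>) has_real_derivative
        s * (\<phi>t x t - \<gamma> * (\<phi> x t - \<rho> x)) * exp (- \<gamma> * (t - a))) (at t)"
      using \<phi>t[of x t] x t by (auto intro!: derivative_eq_intros simp: algebra_simps)
    assume max: "0 < s * (\<phi> x t - \<rho> x) * exp (- \<gamma> * (t - a)) - \<theta>"
      "s * (\<phi>x x t - \<rho>' x) * exp (- \<gamma> * (t - a)) = 0"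
      "s * (\<phi>xx x t - \<rho>'' x) * exp (- \<gamma> * (t - a)) \<le> 0"
    define w where "w = s * (\<phi> x t - \<rho> x)"
    have "0 < w * exp (- \<gamma> * (t - a))" using max(1) \<theta> by (simp add: w_def)
    then have w: "w > 0" by (simp add: zero_less_mult_iff)
    have wx: "\<phi>x x t = \<rho>' x" using max(2) s by auto
    have wxx: "s * (\<phi>xx x t - \<rho>'' x) \<le> 0" using max(3) by (simp add: mult_le_0_iff)
    have "s * \<phi>t x t = s * (\<phi>t x t - eps * (eps / 2 * \<rho>'' x + (2 * \<rho> x - 1) * \<rho>' x
                          + OA * (1 - \<rho> x) - OD * \<rho> x))"
      using ode[OF x] by simp
    also have "\<dots> = eps * (eps / 2 * (s * (\<phi>xx x t - \<rho>'' x)) + 2 * \<rho>' x * w - (OA + OD) * w)"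
      unfolding pde[OF x t] wx w_def by (simp add: algebra_simps)
    also have "\<dots> < eps * (2 * R * w)"
    proof (rule mult_strict_left_mono[OF _ eps])
      have "eps / 2 * (s * (\<phi>xx x t - \<rho>'' x)) \<le> 0"
        using eps wxx mult_nonneg_nonpos[of "eps / 2" "s * (\<phi>xx x t - \<rho>'' x)"] by simp
      moreover have "(OA + OD) * w > 0" using OA OD w by simp
      moreover have "2 * \<rho>' x * w \<le> 2 * R * w" using R[of x] x w by auto
      ultimately show "eps / 2 * (s * (\<phi>xx x t - \<rho>'' x)) + 2 * \<rho>' x * w - (OA + OD) * w
          < 2 * R * w" by linarith
    qed
    finally have "s * (\<phi>t x t - \<gamma> * (\<phi> x t - \<rho> x)) < 0"
      by (simp add: \<gamma>_def w_def algebra_simps)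
    then show "s * (\<phi>t x t - \<gamma> * (\<phi> x t - \<rho> x)) * exp (- \<gamma> * (t - a)) < 0"
      by (simp add: mult_neg_pos)
  next
    fix t :: real assume "a \<le> t"
    then show "s * (\<phi> 0 t - \<rho> 0) * exp (- \<gamma> * (t - a)) - \<theta> \<le> 0 \<and>
               s * (\<phi> 1 t - \<rho> 1) * exp (- \<gamma> * (t - a)) - \<theta> \<le> 0"
      using \<phi>_bc[of t] \<rho>_bc \<theta> \<open>a > 0\<close> by simp
  next
    fix x :: real assume "0 \<le> x" "x \<le> 1"
    then show "s * (\<phi> x a - \<rho> x) * exp (- \<gamma> * (a - a)) - \<theta> \<le> 0"
      using init[of x] s by auto
  qed (use assms in auto)
  have "\<bar>\<phi> x t - \<rho> x\<bar> * exp (- \<gamma> * (t - a)) \<le> \<theta>"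
    using signed[of 1] signed[of "-1"] by (auto simp: abs_if)
  then have "\<bar>\<phi> x t - \<rho> x\<bar> * exp (- \<gamma> * (t - a)) * exp (\<gamma> * (t - a)) \<le> \<theta> * exp (\<gamma> * (t - a))"
    by (intro mult_right_mono) auto
  then show ?thesis by (simp add: \<gamma>_def mult.assoc flip: exp_add)
qed

lemma recurrent_small_difference:
  assumes "\<theta> > 0"
  shows "\<exists>T0 > 0. \<forall>T \<ge> T0. \<exists>t \<in> {T..T + 1}. \<forall>x\<in>{0..1}. \<bar>\<phi> x t - \<rho> x\<bar> \<le> \<theta>"
proof -
  obtain M where M: "\<And>x t. x \<in> {0..1} \<Longrightarrow> t \<ge> 0 \<Longrightarrow> \<bar>\<phi> x t\<bar> \<le> M"
    using density_bounded by blast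
  obtain M' where M': "\<And>x. x \<in> {0..1} \<Longrightarrow> \<bar>\<rho> x\<bar> \<le> M'"
    using continuous_on_Icc_bounded[OF cont_\<rho>] by blast
  define N where "N = M + M' + 1"
  have "M \<ge> 0" "M' \<ge> 0" using M[of 0 0] M'[of 0] by auto
  then have N: "N > 0" by (simp add: N_def)
  define K where "K = OA + OD"
  have K: "K > 0" using OA OD by (simp add: K_def)
  define \<mu> where "\<mu> = eps * K / (2 * N ^ 3)"
  have \<mu>: "\<mu> > 0" using eps K N by (simp add: \<mu>_def)
  define c where "c = eps * K / 2"
  define d where "d = eps\<^sup>2 * \<mu> / 4"
  define C where "C = N\<^sup>2 + eps * K"
  have pos: "c > 0" "d > 0" "C > 0" using eps K \<mu> N by (auto simp: c_def d_def C_def add_pos_pos)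
  define q where "q = C * (2 / c + 1)"
  have q: "q > 0" using pos by (simp add: q_def add_pos_pos)
  define \<delta> where "\<delta> = d * \<theta>\<^sup>2 / (2 * q)"
  have \<delta>: "\<delta> > 0" using pos q assms by (simp add: \<delta>_def)
  have small: "C * \<delta> * (2 / c + 1) < d * \<theta>\<^sup>2"
  proof -
    have "C * \<delta> * (2 / c + 1) = q * \<delta>" by (simp add: q_def)
    moreover have "q * \<delta> = d * \<theta>\<^sup>2 / 2" using q by (simp add: \<delta>_def)
    moreover have "d * \<theta>\<^sup>2 > 0" using pos assms by simp
    ultimately show ?thesis by linarith
  qed
  define E where "E t = integral {0..1} (\<lambda>x. eta \<delta> \<mu> (\<phi> x t - \<rho> x))" for t
  define E' where "E' t = integral {0..1} (\<lambda>x. eta' \<delta> \<mu> (\<phi> x t - \<rho> x) * \<phi>t x t)" for t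
  define D where "D t = integral {0..1} (\<lambda>x. (\<phi>x x t - \<rho>' x)\<^sup>2)" for t
  have cw: "continuous_on {0..1} (\<lambda>x. \<phi> x t - \<rho> x)" if "t > 0" for t
    using \<phi>x[OF _ that] \<rho>'
    by (intro continuous_intros) (meson DERIV_continuous continuous_on_eq_continuous_within)+
  have cwx: "continuous_on {0..1} (\<lambda>x. \<phi>x x t - \<rho>' x)" if "t > 0" for t
    using \<phi>xx[OF _ that] \<rho>''
    by (intro continuous_intros) (meson DERIV_continuous continuous_on_eq_continuous_within)+
  have E_int: "(\<lambda>x. eta \<delta> \<mu> (\<phi> x t - \<rho> x)) integrable_on {0..1}" if "t > 0" for t
    by (intro integrable_continuous_real
        continuous_on_compose2[OF continuous_on_eta[OF \<delta>] cw[OF that]]) auto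
  have "\<exists>T0 > 0. \<forall>T \<ge> T0. \<exists>t \<in> {T..T + 1}. D t \<le> \<theta>\<^sup>2"
  proof (rule recurrent_small_dissipation[where E = E and E' = E' and c = c and \<kappa> = "C * \<delta>" and d = d])
    fix t :: real assume t: "t > 0"
    have swap: "continuous_on ({0<..} \<times> {0..1}) (\<lambda>p. (\<lambda>(x, t). f x t) (snd p, fst p))"
      if "continuous_on ({0..1} \<times> {0<..}) (\<lambda>(x, t). f x t)" for f :: "real \<Rightarrow> real \<Rightarrow> real"
      by (rule continuous_on_compose2[OF that]) (auto intro!: continuous_intros)
    have "continuous_on ({0..1} \<times> {0<..}) (\<lambda>(x, t). \<phi> x t)"
      by (rule continuous_on_subset[OF cont]) auto
    note cont_swap = swap[OF this] swap[OF cont_t]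
    have "continuous_on ({0<..} \<times> {0..1}) (\<lambda>p. \<rho> (snd p))"
      by (rule continuous_on_compose2[OF cont_\<rho>]) (auto intro!: continuous_intros)
    then have "continuous_on ({0<..} \<times> {0..1})
        (\<lambda>p. eta' \<delta> \<mu> (\<phi> (snd p) (fst p) - \<rho> (snd p)) * \<phi>t (snd p) (fst p))"
      using cont_swap
      by (intro continuous_intros continuous_on_compose2[OF continuous_on_eta'[OF \<delta>, of UNIV]]) auto
    then have "((\<lambda>t. integral (cbox 0 1) (\<lambda>x. eta \<delta> \<mu> (\<phi> x t - \<rho> x))) has_field_derivative
        integral (cbox 0 1) (\<lambda>x. eta' \<delta> \<mu> (\<phi> x t - \<rho> x) * \<phi>t x t)) (at t within {0<..})"
    proof (intro leibniz_rule_field_derivative)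
      fix s x :: real assume "s \<in> {0<..}" "x \<in> cbox 0 1"
      then have "((\<lambda>t. \<phi> x t - \<rho> x) has_real_derivative \<phi>t x s) (at s within {0<..})"
        by (auto intro!: derivative_eq_intros has_field_derivative_at_within[OF \<phi>t])
      then show "((\<lambda>t. eta \<delta> \<mu> (\<phi> x t - \<rho> x)) has_field_derivative
          eta' \<delta> \<mu> (\<phi> x s - \<rho> x) * \<phi>t x s) (at s within {0<..})"
        by (rule DERIV_chain2[OF eta_deriv[OF \<delta>]])
    qed (use t E_int in \<open>auto simp: case_prod_unfold\<close>)
    then show "(E has_real_derivative E' t) (at t)"
      using t at_within_open[of t "{0<..}"] unfolding E_def [abs_def] E'_def by simp
    show "E t \<ge> 0" unfolding E_def
      using \<mu> by (intro integral_nonneg E_int t eta_nonneg) auto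
    show "D t \<ge> 0" unfolding D_def
      by (intro integral_nonneg integrable_continuous_real continuous_intros cwx t) auto
    show "E' t \<le> - c * E t + C * \<delta> - d * D t"
      unfolding E'_def E_def D_def c_def C_def d_def
    proof (rule energy_dissipation[OF eps K N \<delta> \<mu>_def, where b = "\<lambda>x. \<phi> x t + \<rho> x - 1"
          and bx = "\<lambda>x. \<phi>x x t + \<rho>' x" and wxx = "\<lambda>x. \<phi>xx x t - \<rho>'' x"])
      fix x :: real assume x: "x \<in> {0..1}"
      show "((\<lambda>x. \<phi> x t - \<rho> x) has_real_derivative \<phi>x x t - \<rho>' x) (at x within {0..1})"
        "((\<lambda>x. \<phi>x x t - \<rho>' x) has_real_derivative \<phi>xx x t - \<rho>'' x) (at x within {0..1})"
        "((\<lambda>x. \<phi> x t + \<rho> x - 1) has_real_derivative \<phi>x x t + \<rho>' x) (at x within {0..1})"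
        using x t by (auto intro!: derivative_eq_intros \<phi>x \<phi>xx \<rho>' \<rho>'')
      show "\<bar>\<phi> x t - \<rho> x\<bar> \<le> N" "\<bar>\<phi> x t + \<rho> x - 1\<bar> \<le> N"
        using M[OF x, of t] M'[OF x] t unfolding N_def by linarith+
    next
      have "continuous_on {0..1} (\<lambda>x. (\<lambda>(x, t). \<phi>t x t) (x, t))"
        using t by (intro continuous_on_compose2[OF cont_t]) (auto intro!: continuous_intros)
      then show "continuous_on {0..1} (\<lambda>x. \<phi>t x t)" by simp
      show "\<phi> 0 t - \<rho> 0 = 0" "\<phi> 1 t - \<rho> 1 = 0" using \<phi>_bc[of t] \<rho>_bc t by auto
    next
      fix x :: real assume x: "0 < x" "x < 1"
      have "\<phi>t x t = \<phi>t x t - eps * (eps / 2 * \<rho>'' x + (2 * \<rho> x - 1) * \<rho>' x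
                          + OA * (1 - \<rho> x) - OD * \<rho> x)"
        using ode[OF x] by simp
      then show "\<phi>t x t = eps * (eps / 2 * (\<phi>xx x t - \<rho>'' x)
          + (\<phi> x t + \<rho> x - 1) * (\<phi>x x t - \<rho>' x) + (\<phi>x x t + \<rho>' x) * (\<phi> x t - \<rho> x)
          - K * (\<phi> x t - \<rho> x))"
        unfolding pde[OF x t] K_def by (simp add: algebra_simps)
    qed
  qed (use pos \<delta> small in auto)
  then obtain T0 where "T0 > 0" and T0: "\<And>T. T \<ge> T0 \<Longrightarrow> \<exists>t \<in> {T..T + 1}. D t \<le> \<theta>\<^sup>2" by blast
  have "\<exists>t \<in> {T..T + 1}. \<forall>x\<in>{0..1}. \<bar>\<phi> x t - \<rho> x\<bar> \<le> \<theta>" if T: "T \<ge> T0" for T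
  proof -
    obtain t where t: "t \<in> {T..T + 1}" "D t \<le> \<theta>\<^sup>2" using T0[OF T] by blast
    then have t0: "t > 0" using T \<open>T0 > 0\<close> by auto
    have "\<bar>\<phi> x t - \<rho> x\<bar> \<le> \<theta>" if "x \<in> {0..1}" for x
    proof (rule sup_le_of_derivative_L2_le[where w = "\<lambda>x. \<phi> x t - \<rho> x" and wx = "\<lambda>x. \<phi>x x t - \<rho>' x"])
      show "integral {0..1} (\<lambda>x. (\<phi>x x t - \<rho>' x)\<^sup>2) \<le> \<theta>\<^sup>2" using t(2) by (simp add: D_def)
      show "\<phi> 0 t - \<rho> 0 = 0" using \<phi>_bc[of t] \<rho>_bc t0 by simp
    qed (use that t0 assms cwx \<phi>x \<rho>' in \<open>auto intro!: derivative_eq_intros\<close>)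
    then show ?thesis using t(1) by blast
  qed
  then show ?thesis using \<open>T0 > 0\<close> by blast
qed

lemma uniform_convergence: "uniform_limit {0..1} (\<lambda>t x. \<phi> x t) \<rho> at_top"
proof (rule uniform_limitI)
  fix e :: real assume e: "e > 0"
  obtain R where R: "\<And>x. x \<in> {0..1} \<Longrightarrow> \<bar>\<rho>' x\<bar> \<le> R"
    using continuous_on_Icc_bounded[OF cont_\<rho>'] by blast
  have R0: "R \<ge> 0" using R[of 0] by auto
  define \<theta> where "\<theta> = e / 2 * exp (- (2 * eps * R))"
  have \<theta>: "\<theta> > 0" using e by (simp add: \<theta>_def)
  obtain T0 where "T0 > 0"
    and T0: "\<And>T. T \<ge> T0 \<Longrightarrow> \<exists>t \<in> {T..T + 1}. \<forall>x\<in>{0..1}. \<bar>\<phi> x t - \<rho> x\<bar> \<le> \<theta>"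
    using recurrent_small_difference[OF \<theta>] by blast
  have "\<forall>x\<in>{0..1}. dist (\<phi> x t) (\<rho> x) < e" if t: "t \<ge> T0 + 1" for t
  proof
    fix x :: real assume x: "x \<in> {0..1}"
    obtain a where a: "t - 1 \<le> a" "a \<le> t" "\<And>y. y \<in> {0..1} \<Longrightarrow> \<bar>\<phi> y a - \<rho> y\<bar> \<le> \<theta>"
      using T0[of "t - 1"] t by auto
    have "a > 0" using a t \<open>T0 > 0\<close> by simp
    then have "\<bar>\<phi> x t - \<rho> x\<bar> \<le> \<theta> * exp (2 * eps * R * (t - a))"
      using difference_growth[OF R _ a(2) x a(3)] by simp
    also have "\<dots> \<le> \<theta> * exp (2 * eps * R * 1)"
      using \<theta> eps R0 a(1) by (intro mult_left_mono iffD2[OF exp_le_cancel_iff]) auto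
    also have "\<dots> = e / 2" by (simp add: \<theta>_def mult.assoc flip: exp_add)
    finally show "dist (\<phi> x t) (\<rho> x) < e" using e by (simp add: dist_real_def)
  qed
  then show "\<forall>\<^sub>F t in at_top. \<forall>x\<in>{0..1}. dist (\<phi> x t) (\<rho> x) < e"
    unfolding eventually_at_top_linorder by blast
qed

end

theorem mainTheorem2:
  fixes eps OA OD \<alpha> \<beta> :: real and \<rho> :: "real \<Rightarrow> real"
  assumes "eps > 0" and "OA > 0" and "OD > 0"
    and "smooth_01 \<rho>" and "solves_S eps OA OD \<alpha> \<beta> \<rho>"
    and "\<forall>r. smooth_01 r \<and> solves_S eps OA OD \<alpha> \<beta> r \<longrightarrow> (\<forall>x\<in>{0..1}. r x = \<rho> x)"
  shows "\<forall>\<sigma> \<phi>. \<sigma> \<in> Xspace \<alpha> \<beta> \<and> solves_P eps OA OD \<alpha> \<beta> \<sigma> \<phi> \<longrightarrow>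
           uniform_limit {0..1} (\<lambda>t x. \<phi> x t) \<rho> at_top"
proof (intro allI impI)
  fix \<sigma> \<phi> assume "\<sigma> \<in> Xspace \<alpha> \<beta> \<and> solves_P eps OA OD \<alpha> \<beta> \<sigma> \<phi>"
  then have P: "solves_P eps OA OD \<alpha> \<beta> \<sigma> \<phi>" by simp
  obtain \<phi>x \<phi>xx \<phi>t where
    "continuous_on ({0..1} \<times> {0<..}) (\<lambda>(x, t). \<phi>t x t)"
    "\<forall>x\<in>{0..1}. \<forall>t>0.
        ((\<lambda>y. \<phi> y t) has_real_derivative \<phi>x x t) (at x within {0..1})
      \<and> ((\<lambda>y. \<phi>x y t) has_real_derivative \<phi>xx x t) (at x within {0..1})
      \<and> ((\<lambda>s. \<phi> x s) has_real_derivative \<phi>t x t) (at t)"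
    "\<forall>x\<in>{0<..<1}. \<forall>t>0.
        \<phi>t x t = eps * (eps / 2 * \<phi>xx x t + (2 * \<phi> x t - 1) * \<phi>x x t
                         + OA * (1 - \<phi> x t) - OD * \<phi> x t)"
    using P unfolding solves_P_def by (elim conjE exE) (rule that)
  moreover obtain \<rho>' \<rho>'' where
    "\<forall>x\<in>{0..1}. (\<rho> has_real_derivative \<rho>' x) (at x within {0..1})
      \<and> (\<rho>' has_real_derivative \<rho>'' x) (at x within {0..1})"
    "\<forall>x\<in>{0<..<1}. eps / 2 * \<rho>'' x + (2 * \<rho> x - 1) * \<rho>' x
                    + OA * (1 - \<rho> x) - OD * \<rho> x = 0"
    using assms(5) unfolding solves_S_def by (elim conjE exE) (rule that)
  moreover have "continuous_on ({0..1} \<times> {0..}) (\<lambda>(x, t). \<phi> x t)"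
    "\<forall>t\<ge>0. \<phi> 0 t = \<alpha> \<and> \<phi> 1 t = 1 - \<beta>" "\<rho> 0 = \<alpha>" "\<rho> 1 = 1 - \<beta>"
    using P assms(5) unfolding solves_P_def solves_S_def by blast+
  ultimately interpret density_and_profile eps OA OD \<alpha> \<beta> \<phi> \<phi>x \<phi>xx \<phi>t \<rho> \<rho>' \<rho>''
    using assms(1-3) by unfold_locales simp_all
  show "uniform_limit {0..1} (\<lambda>t x. \<phi> x t) \<rho> at_top" by (rule uniform_convergence)
qed

end
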